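(* Fix a variable $x_i$ and $d\ge1$. Let $V_0\subseteq Q_d$ and $V_1\subseteq Q_{d-1}$ be monomial vector spaces which are Gotzmann in $Q=R/(x_i)$ and satisfy $V_0=\mathbf n_1V_1$. Then $V=V_0\oplus x_iV_1\subseteq R_d$ is Gotzmann in $R$.
   Context: Let $\Bbbk$ be a field, $R=\Bbbk[x_1,\dots,x_n]/(x_1^2,\dots,x_n^2)$, $R_d$ its degree-$d$ component. A monomial vector space is a subspace of some $R_d$ spanned by monomials; $\mathbf m_1V$ is the span of $\{x_jm\}$ over monomials $m\in V$ and all $j$. A subspace $V\subseteq R_d$ is Gotzmann if $|\mathbf m_1V|\le|\mathbf m_1W|$ for every subspace $W\subseteq R_d$ with $|W|=|V|$ ($|\cdot|$ = dimension). $Q=R/(x_i)$ is the squarefree ring in the variables other than $x_i$, viewed as the subspace of $R$ spanned by monomials not divisible by $x_i$; $\mathbf n_1W$ is the span of $\{x_jm: j\neq i, m\in W\text{ monomial}\}$, and Gotzmann in $Q$ is defined analogously. *)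

theory Defs
  imports Main HOL.Vector_Spaces "HOL-Library.Function_Algebras"
begin

text \<open>Elements of R = k[x_0,...,x_{n-1}]/(x_0^2,...,x_{n-1}^2) are represented as
  coefficient functions on squarefree monomials, a squarefree monomial being
  identified with its set of variables (a subset of {..<n}).\<close>

type_synonym 'k elt = "nat set \<Rightarrow> 'k"

definition sc :: "'k::field \<Rightarrow> 'k elt \<Rightarrow> 'k elt" where
  "sc c f = (\<lambda>S. c * f S)"

definition vdim :: "'k::field elt set \<Rightarrow> nat" where
  "vdim V = vector_space.dim sc V"

definition vspan :: "'k::field elt set \<Rightarrow> 'k elt set" where
  "vspan V = module.span sc V"

definition vsubspace :: "'k::field elt set \<Rightarrow> bool" where
  "vsubspace V = module.subspace sc V"

definition mono :: "nat set \<Rightarrow> 'k::field elt" where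
  "mono S = (\<lambda>T. if T = S then 1 else 0)"

definition mulx :: "nat \<Rightarrow> 'k::field elt \<Rightarrow> 'k elt" where
  "mulx j f = (\<lambda>S. if j \<in> S then f (S - {j}) else 0)"

text \<open>Squarefree monomials of degree d in n variables (for R), and those not
  divisible by x_i (for Q = R/(x_i)).\<close>
definition monsR :: "nat \<Rightarrow> nat \<Rightarrow> nat set set" where
  "monsR n d = {S. S \<subseteq> {..<n} \<and> card S = d}"

definition monsQ :: "nat \<Rightarrow> nat \<Rightarrow> nat \<Rightarrow> nat set set" where
  "monsQ n i d = {S. S \<subseteq> {..<n} - {i} \<and> card S = d}"

text \<open>Elements supported on a given set of monomials, i.e. the span of them.
  R_d = elts_on (monsR n d), Q_d = elts_on (monsQ n i d).\<close>
definition elts_on :: "nat set set \<Rightarrow> 'k::field elt set" where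
  "elts_on Mons = {f. \<forall>S. f S \<noteq> 0 \<longrightarrow> S \<in> Mons}"

definition m1 :: "nat \<Rightarrow> 'k::field elt set \<Rightarrow> 'k elt set" where
  "m1 n W = vspan (\<Union>j\<in>{..<n}. mulx j ` W)"

definition n1 :: "nat \<Rightarrow> nat \<Rightarrow> 'k::field elt set \<Rightarrow> 'k elt set" where
  "n1 n i W = vspan (\<Union>j\<in>{..<n} - {i}. mulx j ` W)"

definition monomial_space_in :: "nat set set \<Rightarrow> 'k::field elt set \<Rightarrow> bool" where
  "monomial_space_in Mons V \<longleftrightarrow> (\<exists>M \<subseteq> Mons. V = vspan (mono ` M))"

definition gotzmann_R :: "nat \<Rightarrow> nat \<Rightarrow> 'k::field elt set \<Rightarrow> bool" where
  "gotzmann_R n d V \<longleftrightarrow> vsubspace V \<and> V \<subseteq> elts_on (monsR n d) \<and>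
     (\<forall>W :: 'k elt set. vsubspace W \<and> W \<subseteq> elts_on (monsR n d) \<and> vdim W = vdim V \<longrightarrow> vdim (m1 n V) \<le> vdim (m1 n W))"

definition gotzmann_Q :: "nat \<Rightarrow> nat \<Rightarrow> nat \<Rightarrow> 'k::field elt set \<Rightarrow> bool" where
  "gotzmann_Q n i d V \<longleftrightarrow> vsubspace V \<and> V \<subseteq> elts_on (monsQ n i d) \<and>
     (\<forall>W :: 'k elt set. vsubspace W \<and> W \<subseteq> elts_on (monsQ n i d) \<and> vdim W = vdim V \<longrightarrow> vdim (n1 n i V) \<le> vdim (n1 n i W))"

end

theory Submission
  imports Defs "HOL-Library.Nat_Bijection"
begin

text \<open>Passing to leading monomials replaces an arbitrary competitor by a family \<open>A\<close> of
  \<open>d\<close>-sets with no larger upper shadow, and shifting \<open>i \<rightarrow> j\<close> for every \<open>j\<close> makes \<open>A\<close> stable: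
  if \<open>A\<^sub>0\<close> consists of the members avoiding \<open>i\<close> and \<open>A\<^sub>1\<close> of the links of \<open>i\<close>, the shadow of
  \<open>A\<^sub>1\<close> in \<open>Q\<close> lies in \<open>A\<^sub>0\<close>. Since \<open>|A\<^sub>0| + |A\<^sub>1| = |V\<^sub>0| + |V\<^sub>1|\<close> and \<open>V\<^sub>1\<close> is Gotzmann with
  \<open>V\<^sub>0 = n\<^sub>1 V\<^sub>1\<close>, this forces \<open>|A\<^sub>0| \<ge> |V\<^sub>0|\<close>. The shadow of \<open>A\<close> has at least
  \<open>|n\<^sub>1 A\<^sub>0| + |A\<^sub>0|\<close> elements, hence at least \<open>|n\<^sub>1 V\<^sub>0| + |V\<^sub>0| = |m\<^sub>1 V|\<close> as \<open>V\<^sub>0\<close> is Gotzmann.\<close>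

section \<open>Upper shadows and shifting\<close>

text \<open>The condition \<open>j \<notin> S\<close> encodes x_j^2 = 0: a product with a repeated
  variable vanishes. Taking all variables as \<open>J\<close> models multiplication in R; leaving
  out \<open>i\<close> models it in Q.\<close>

definition shadow :: "'a set \<Rightarrow> 'a set set \<Rightarrow> 'a set set" where
  "shadow J A = {insert j S | j S. j \<in> J \<and> S \<in> A \<and> j \<notin> S}"

lemma shadowI: "j \<in> J \<Longrightarrow> S \<in> A \<Longrightarrow> j \<notin> S \<Longrightarrow> insert j S \<in> shadow J A"
  by (auto simp: shadow_def)

lemma shadowE:
  assumes "T \<in> shadow J A"
  obtains j S where "j \<in> J" "S \<in> A" "j \<notin> S" "T = insert j S"
  using assms by (auto simp: shadow_def)

lemma shadow_mono: "A \<subseteq> B \<Longrightarrow> shadow J A \<subseteq> shadow J B"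
  by (auto simp: shadow_def)

lemma finite_shadow: "finite J \<Longrightarrow> finite A \<Longrightarrow> finite (shadow J A)"
  by (rule finite_subset[of _ "(\<lambda>(j, S). insert j S) ` (J \<times> A)"]) (auto simp: shadow_def)

definition shift_set :: "'a \<Rightarrow> 'a \<Rightarrow> 'a set \<Rightarrow> 'a set" where
  "shift_set i j S = (if i \<in> S \<and> j \<notin> S then insert j (S - {i}) else S)"

text \<open>The classical compression of extremal set theory. A set moves only when its image is not
  yet in \<open>A\<close>, so stationary and moved members cannot collide.\<close>

definition shift :: "'a \<Rightarrow> 'a \<Rightarrow> 'a set set \<Rightarrow> 'a set set" where
  "shift i j A = (\<lambda>S. if shift_set i j S \<in> A then S else shift_set i j S) ` A"

lemma shift_iff:
  "T \<in> shift i j A \<longleftrightarrow>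
     T \<in> A \<and> shift_set i j T \<in> A \<or> T \<notin> A \<and> (\<exists>S\<in>A. T = shift_set i j S)"
  unfolding shift_def by (auto simp: image_iff)

text \<open>A set that really moves is recovered from its image by exchanging \<open>j\<close> back
  for \<open>i\<close>. This rules out collisions among moved sets in
  \<open>card_shift\<close>.\<close>

lemma shift_set_inject:
  assumes "shift_set i j S = shift_set i j T" "shift_set i j S \<noteq> S" "shift_set i j T \<noteq> T"
  shows "S = T"
proof -
  have "U = insert i (shift_set i j U - {j})" if "shift_set i j U \<noteq> U" for U
    using that unfolding shift_set_def by (cases "i \<in> U \<and> j \<notin> U") auto
  then show ?thesis using assms by metis
qed

lemma card_shift: "card (shift i j A) = card A"
  unfolding shift_def
  by (rule card_image, rule inj_onI) (metis shift_set_inject)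

text \<open>Together with \<open>card_shift\<close> this shows that compression never enlarges the
  shadow of a finite family.\<close>

lemma shadow_shift_subset:
  assumes "i \<in> J" "j \<in> J" "i \<noteq> j"
  shows "shadow J (shift i j A) \<subseteq> shift i j (shadow J A)"
proof
  fix T assume "T \<in> shadow J (shift i j A)"
  then obtain k S' where k: "k \<in> J" "S' \<in> shift i j A" "k \<notin> S'" "T = insert k S'"
    by (rule shadowE)
  from k(2) consider "S' \<in> A" "shift_set i j S' \<in> A"
    | S where "S' \<notin> A" "S \<in> A" "S' = shift_set i j S"
    by (auto simp: shift_iff)
  then show "T \<in> shift i j (shadow J A)"
  proof cases
    case 1
    have T: "T \<in> shadow J A" using k 1 by (auto intro: shadowI)
    \<comment> \<open>A member \<open>T\<close> of the shadow survives the shift if its image is in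
      the shadow too. When \<open>T\<close> moves, that image extends \<open>S'\<close> by
      \<open>j\<close> if \<open>k = i\<close>, and otherwise extends the shifted \<open>S'\<close>
      by \<open>k\<close>.\<close>
    have "shift_set i j T \<in> shadow J A"
    proof (cases "i \<in> T \<and> j \<notin> T")
      case False
      then show ?thesis using T by (auto simp: shift_set_def)
    next
      case True
      show ?thesis
      proof (cases "k = i")
        case True
        then have "shift_set i j T = insert j S'"
          using k \<open>i \<in> T \<and> j \<notin> T\<close> by (auto simp: shift_set_def)
        then show ?thesis using k 1 assms True \<open>i \<in> T \<and> j \<notin> T\<close> by (auto intro: shadowI)
      next
        case False
        then have "shift_set i j T = insert k (shift_set i j S')" "k \<notin> shift_set i j S'"
          using k \<open>i \<in> T \<and> j \<notin> T\<close> by (auto simp: shift_set_def)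
        then show ?thesis using k 1 by (auto intro: shadowI)
      qed
    qed
    with T show ?thesis by (simp add: shift_iff)
  next
    case 2
    then have S: "i \<in> S" "j \<notin> S" "S' = insert j (S - {i})"
      by (auto simp: shift_set_def split: if_splits)
    \<comment> \<open>\<open>T\<close> contains \<open>j\<close>, so shifting fixes it. It is
      therefore in the shifted shadow as soon as it lies in the shadow of \<open>A\<close> or is the
      image of a member of that shadow.\<close>
    then have fix_T: "shift_set i j T = T" using k by (auto simp: shift_set_def)
    show ?thesis
    proof (cases "k = i")
      case True
      then have "T = insert j S" using S k by auto
      then have "T \<in> shadow J A" using S 2 assms by (auto intro: shadowI)
      then show ?thesis using fix_T by (simp add: shift_iff)
    next
      case False
      then have "T = shift_set i j (insert k S)" "k \<notin> S"
        using S k by (auto simp: shift_set_def)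
      moreover from this have "insert k S \<in> shadow J A" using 2 k by (auto intro: shadowI)
      ultimately show ?thesis using fix_T by (metis shift_iff)
    qed
  qed
qed

lemma card_shift_set: "finite S \<Longrightarrow> card (shift_set i j S) = card S"
  by (auto simp: shift_set_def card.insert_remove card_Suc_Diff1 simp del: card_Diff_insert)

lemma shift_monsR:
  assumes "A \<subseteq> monsR n d" "j < n"
  shows "shift i j A \<subseteq> monsR n d"
proof -
  have "shift_set i j S \<in> monsR n d" if "S \<in> monsR n d" for S
  proof -
    have "finite S" using that by (auto simp: monsR_def intro: finite_subset)
    then have "card (shift_set i j S) = d"
      using that by (simp add: card_shift_set monsR_def)
    moreover have "shift_set i j S \<subseteq> {..<n}"
      using that assms(2) by (auto simp: monsR_def shift_set_def)
    ultimately show ?thesis by (simp add: monsR_def)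
  qed
  then show ?thesis using assms unfolding shift_def by (auto simp: subset_iff)
qed

text \<open>Arrivals have lost \<open>i\<close>, so the members containing \<open>i\<close> can only
  become fewer, and \<open>S\<close> itself departs. This is the measure that makes repeated
  shifting stop.\<close>

lemma card_shift_star_less:
  assumes "finite A" "i \<noteq> j" "S \<in> A" "shift_set i j S \<notin> A"
  shows "card {T \<in> shift i j A. i \<in> T} < card {T \<in> A. i \<in> T}"
proof (rule psubset_card_mono)
  have "shift_set i j S \<noteq> S" using assms by auto
  then have "i \<in> S" by (auto simp: shift_set_def split: if_splits)
  moreover have "S \<notin> shift i j A" using assms by (simp add: shift_iff)
  moreover have "{T \<in> shift i j A. i \<in> T} \<subseteq> {T \<in> A. i \<in> T}"
    using assms(2) by (auto simp: shift_iff shift_set_def split: if_splits)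
  ultimately show "{T \<in> shift i j A. i \<in> T} \<subset> {T \<in> A. i \<in> T}" using assms(3) by blast
qed (use assms in auto)

section \<open>Stable families and the shadow of a cone\<close>

lemma finite_monsR: "finite (monsR n d)"
  by (rule finite_subset[of _ "Pow {..<n}"]) (auto simp: monsR_def)

lemma finite_monsQ: "finite (monsQ n i d)"
  by (rule finite_subset[of _ "Pow {..<n}"]) (auto simp: monsQ_def)

text \<open>Each failure of the exchange property gives a shift that really moves a set. Performing
  it keeps the size, does not enlarge the shadow and lowers the number of members containing
  \<open>i\<close>.\<close>

lemma stable_family_exists:
  assumes "A \<subseteq> monsR n d" "i < n"
  obtains B where "B \<subseteq> monsR n d" "card B = card A"
    "card (shadow {..<n} B) \<le> card (shadow {..<n} A)"
    "\<And>S j. S \<in> B \<Longrightarrow> i \<in> S \<Longrightarrow> j < n \<Longrightarrow> j \<notin> S \<Longrightarrow> insert j (S - {i}) \<in> B"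
  using assms(1)
proof (induction "card {T \<in> A. i \<in> T}" arbitrary: A thesis rule: less_induct)
  case less
  have fin: "finite A" using less.prems finite_monsR finite_subset by blast
  show ?case
  proof (cases "\<exists>S j. S \<in> A \<and> j < n \<and> i \<in> S \<and> j \<notin> S \<and> insert j (S - {i}) \<notin> A")
    case False
    show ?thesis by (rule less.prems(1)[of A]) (use False less.prems in auto)
  next
    case True
    then obtain S j where S: "S \<in> A" "j < n" "i \<in> S" "j \<notin> S" "insert j (S - {i}) \<notin> A"
      by blast
    then have ne: "i \<noteq> j" and sh: "shift_set i j S \<notin> A" by (auto simp: shift_set_def)
    have "card (shadow {..<n} (shift i j A)) \<le> card (shift i j (shadow {..<n} A))"
      by (rule card_mono)
        (use fin S ne assms(2) shadow_shift_subset[of i "{..<n}" j A] in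
          \<open>auto simp: shift_def finite_shadow\<close>)
    then have le: "card (shadow {..<n} (shift i j A)) \<le> card (shadow {..<n} A)"
      by (simp add: card_shift)
    obtain B where B: "B \<subseteq> monsR n d" "card B = card (shift i j A)"
      "card (shadow {..<n} B) \<le> card (shadow {..<n} (shift i j A))"
      "\<And>S j. S \<in> B \<Longrightarrow> i \<in> S \<Longrightarrow> j < n \<Longrightarrow> j \<notin> S \<Longrightarrow> insert j (S - {i}) \<in> B"
      using less.hyps[OF card_shift_star_less[OF fin ne S(1) sh]]
        shift_monsR[OF less.prems(2) S(2)] by metis
    show ?thesis
      by (rule less.prems(1)[of B]) (use B le in \<open>auto simp: card_shift\<close>)
  qed
qed

text \<open>The combinatorial core: \<open>min0\<close> and \<open>min1\<close> are the Gotzmann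
  conditions tested on monomial spaces only, and \<open>A\<close> is a monomial competitor of the
  cone.\<close>

lemma card_shadow_cone_le:
  assumes "i < n" "d \<ge> 1" "M1 \<subseteq> monsQ n i (d - 1)"
    and M0: "M0 = shadow ({..<n} - {i}) M1"
    and min0: "\<And>B. B \<subseteq> monsQ n i d \<Longrightarrow> card B = card M0 \<Longrightarrow>
      card (shadow ({..<n} - {i}) M0) \<le> card (shadow ({..<n} - {i}) B)"
    and min1: "\<And>B. B \<subseteq> monsQ n i (d - 1) \<Longrightarrow> card B = card M1 \<Longrightarrow>
      card (shadow ({..<n} - {i}) M1) \<le> card (shadow ({..<n} - {i}) B)"
    and A: "A \<subseteq> monsR n d" "card A = card (M0 \<union> insert i ` M1)"
  shows "card (shadow {..<n} (M0 \<union> insert i ` M1)) \<le> card (shadow {..<n} A)"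
proof -
  let ?Q = "{..<n} - {i}"
  obtain B where B: "B \<subseteq> monsR n d" "card B = card A"
    "card (shadow {..<n} B) \<le> card (shadow {..<n} A)"
    and stable: "\<And>S j. S \<in> B \<Longrightarrow> i \<in> S \<Longrightarrow> j < n \<Longrightarrow> j \<notin> S \<Longrightarrow> insert j (S - {i}) \<in> B"
    using stable_family_exists[OF A(1) assms(1)] by metis
  define B0 where "B0 = {S \<in> B. i \<notin> S}"
  define B1 where "B1 = {S. i \<notin> S \<and> insert i S \<in> B}"
  have finM1: "finite M1" using assms(3) finite_monsQ finite_subset by blast
  then have finM0: "finite M0" by (simp add: M0 finite_shadow)
  have M1i: "i \<notin> S" if "S \<in> M1" for S using that assms(3) by (auto simp: monsQ_def)
  have M0i: "i \<notin> S" if "S \<in> M0" for S using that M1i by (auto simp: M0 shadow_def)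
  have inj: "inj_on (insert i) F" if "\<And>S. S \<in> F \<Longrightarrow> i \<notin> S" for F :: "nat set set"
    by (rule inj_onI) (metis that insert_ident)
  have finB: "finite B" using B(1) finite_monsR finite_subset by blast
  have B_split: "B = B0 \<union> insert i ` B1"
  proof -
    have "S \<in> insert i ` B1" if "S \<in> B" "i \<in> S" for S
      by (rule image_eqI[of _ _ "S - {i}"]) (use that in \<open>auto simp: B1_def insert_absorb\<close>)
    then show ?thesis by (auto simp: B0_def B1_def)
  qed
  have card_B1: "card (insert i ` B1) = card B1"
    by (rule card_image[OF inj]) (simp add: B1_def)
  have card_B0: "card (insert i ` B0) = card B0"
    by (rule card_image[OF inj]) (simp add: B0_def)
  have card_M1: "card (insert i ` M1) = card M1"
    by (rule card_image[OF inj]) (rule M1i)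
  have finB0: "finite B0" using finB by (simp add: B0_def)
  have finB1: "finite B1"
    by (rule finite_imageD[of "insert i"])
      (use finB in \<open>auto simp: B1_def intro: inj finite_subset[of _ B]\<close>)
  have B0_sub: "B0 \<subseteq> monsQ n i d" using B(1) by (auto simp: B0_def monsQ_def monsR_def)
  have B1_sub: "B1 \<subseteq> monsQ n i (d - 1)"
  proof
    fix S assume "S \<in> B1"
    then have S: "i \<notin> S" "insert i S \<subseteq> {..<n}" "card (insert i S) = d"
      using B(1) by (auto simp: B1_def monsR_def)
    then have "finite S" by (metis finite_insert finite_lessThan finite_subset)
    then show "S \<in> monsQ n i (d - 1)" using S by (auto simp: monsQ_def)
  qed
  have "card (M0 \<union> insert i ` M1) = card M0 + card M1"
    using finM0 finM1 M0i
    by (subst card_Un_disjoint) (auto simp: card_M1)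
  moreover have "card B = card B0 + card B1"
  proof -
    have "B0 \<inter> insert i ` B1 = {}" by (auto simp: B0_def)
    then show ?thesis using finB0 finB1 card_Un_disjoint[of B0 "insert i ` B1"]
      by (simp add: card_B1 flip: B_split)
  qed
  ultimately have cards: "card B0 + card B1 = card M0 + card M1" using A(2) B(2) by simp
  have B1_shadow: "shadow ?Q B1 \<subseteq> B0"
  proof
    fix T assume "T \<in> shadow ?Q B1"
    then obtain j S where S: "j \<in> ?Q" "S \<in> B1" "j \<notin> S" "T = insert j S" by (rule shadowE)
    \<comment> \<open>Stability is applied to \<open>insert i S\<close>; exchanging \<open>i\<close>
      for \<open>j\<close> there yields \<open>insert j S\<close>.\<close>
    then have "insert j (insert i S - {i}) \<in> B"
      by (intro stable) (auto simp: B1_def)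
    then show "T \<in> B0" using S by (auto simp: B0_def B1_def)
  qed
  have le: "card M0 \<le> card B0"
  \<comment> \<open>If \<open>B1\<close> is no larger than \<open>M1\<close>, counting suffices.
    Otherwise \<open>min1\<close> applies to a subfamily of \<open>B1\<close> of size
    \<open>card M1\<close>, whose shadow still lies in \<open>B0\<close>.\<close>
  proof (cases "card B1 \<le> card M1")
    case True
    then show ?thesis using cards by simp
  next
    case False
    then obtain C where C: "C \<subseteq> B1" "card C = card M1"
      by (meson nle_le obtain_subset_with_card_n)
    have "card M0 \<le> card (shadow ?Q C)"
      unfolding M0 by (rule min1) (use C B1_sub in auto)
    also have "\<dots> \<le> card B0"
      using C(1) B1_shadow shadow_mono finB0 by (metis card_mono order_trans)
    finally show ?thesis .
  qed
  \<comment> \<open>\<open>min0\<close> compares families of equal size, so \<open>B0\<close> is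
    first trimmed to the size of \<open>M0\<close>.\<close>
  obtain C where C: "C \<subseteq> B0" "card C = card M0"
    using le by (meson obtain_subset_with_card_n)
  have "card (shadow ?Q M0) \<le> card (shadow ?Q C)"
    by (rule min0) (use C B0_sub in auto)
  also have "\<dots> \<le> card (shadow ?Q B0)"
    by (rule card_mono) (simp_all add: finite_shadow finB0 shadow_mono[OF C(1)])
  finally have le0: "card (shadow ?Q M0) \<le> card (shadow ?Q B0)" .
  \<comment> \<open>Extending a member of x_i \<open>M1\<close> gives x_i times a member of the
    shadow of \<open>M1\<close>, which is \<open>M0\<close>. Thus it adds nothing beyond x_i
    \<open>M0\<close>.\<close>
  have "shadow {..<n} (M0 \<union> insert i ` M1) \<subseteq> shadow ?Q M0 \<union> insert i ` M0"
  proof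
    fix T assume "T \<in> shadow {..<n} (M0 \<union> insert i ` M1)"
    then obtain j S where S: "j < n" "S \<in> M0 \<union> insert i ` M1" "j \<notin> S" "T = insert j S"
      by (auto simp: shadow_def)
    show "T \<in> shadow ?Q M0 \<union> insert i ` M0"
    proof (cases "S \<in> M0")
      case True
      then show ?thesis using S by (cases "j = i") (auto intro: shadowI)
    next
      case False
      then obtain S1 where S1: "S1 \<in> M1" "S = insert i S1" using S by auto
      then have "insert j S1 \<in> M0" unfolding M0 using S by (auto intro: shadowI)
      then show ?thesis using S S1 by (auto simp: insert_commute)
    qed
  qed
  then have "card (shadow {..<n} (M0 \<union> insert i ` M1)) \<le> card (shadow ?Q M0 \<union> insert i ` M0)"
    using finM0 by (intro card_mono) (auto simp: finite_shadow)
  also have "\<dots> \<le> card (shadow ?Q M0) + card M0"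
    by (rule order_trans[OF card_Un_le]) (simp add: card_image_le finM0)
  also have "\<dots> \<le> card (shadow ?Q B0) + card B0" using le le0 by simp
  \<comment> \<open>The pieces are disjoint, since one avoids \<open>i\<close> and the other
    contains it. Both arise by extending members of \<open>B0\<close> alone.\<close>
  also have "\<dots> = card (shadow ?Q B0 \<union> insert i ` B0)"
  proof -
    have "shadow ?Q B0 \<inter> insert i ` B0 = {}" by (auto simp: B0_def shadow_def)
    then show ?thesis using finB0 card_Un_disjoint[of "shadow ?Q B0" "insert i ` B0"]
      by (simp add: finite_shadow card_B0)
  qed
  also have "\<dots> \<le> card (shadow {..<n} B)"
    by (rule card_mono[OF finite_shadow[OF _ finB]])
      (use assms(1) in \<open>auto simp: B0_def shadow_def\<close>)
  finally show ?thesis using B(3) by simp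
qed

section \<open>Leading monomials\<close>

interpretation elt: vector_space "sc :: 'k::field \<Rightarrow> 'k elt \<Rightarrow> 'k elt"
  by unfold_locales (auto simp: sc_def fun_eq_iff algebra_simps)

text \<open>Squarefree monomials are ordered by their binary encoding. It is injective on finite sets
  only, hence the finiteness hypotheses below.\<close>

definition is_lead :: "'k::field elt \<Rightarrow> nat set \<Rightarrow> bool" where
  "is_lead f T \<longleftrightarrow> f T \<noteq> 0 \<and> (\<forall>S. f S \<noteq> 0 \<longrightarrow> set_encode S \<le> set_encode T)"

definition leads :: "'k::field elt set \<Rightarrow> nat set set" where
  "leads W = {T. \<exists>f\<in>W. is_lead f T}"

lemma sum_apply:
  fixes f :: "'a \<Rightarrow> 'k::field elt"
  shows "(\<Sum>x\<in>A. f x) S = (\<Sum>x\<in>A. f x S)"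
  by (induction A rule: infinite_finite_induct) auto

lemma subspace_elts_on: "elt.subspace (elts_on M :: 'k::field elt set)"
  by (rule elt.subspaceI) (auto simp: elts_on_def sc_def, metis add_0)

lemma elts_on_eq_span:
  assumes "finite M"
  shows "(elts_on M :: 'k::field elt set) = elt.span (mono ` M)"
proof
  show "elt.span (mono ` M) \<subseteq> (elts_on M :: 'k elt set)"
    by (rule elt.span_minimal[OF _ subspace_elts_on]) (auto simp: elts_on_def mono_def split: if_splits)
  show "(elts_on M :: 'k elt set) \<subseteq> elt.span (mono ` M)"
  proof
    fix f :: "'k elt" assume f: "f \<in> elts_on M"
    have "f = (\<Sum>S\<in>M. sc (f S) (mono S))"
    proof
      fix T
      have "(\<Sum>S\<in>M. sc (f S) (mono S)) T = (\<Sum>S\<in>M. if T = S then f S else 0)"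
        unfolding sum_apply by (intro sum.cong) (auto simp: sc_def mono_def)
      also have "\<dots> = f T" using f assms by (auto simp: elts_on_def)
      finally show "f T = (\<Sum>S\<in>M. sc (f S) (mono S)) T" by simp
    qed
    also have "\<dots> \<in> elt.span (mono ` M)"
      by (intro elt.span_sum elt.span_scale elt.span_base) auto
    finally show "f \<in> elt.span (mono ` M)" .
  qed
qed

lemma leads_subset: "W \<subseteq> elts_on M \<Longrightarrow> leads W \<subseteq> M"
  by (auto simp: leads_def is_lead_def elts_on_def)

lemma leads_elts_on: "leads (elts_on M :: 'k::field elt set) = M"
proof
  show "M \<subseteq> leads (elts_on M :: 'k elt set)"
  proof
    fix T assume "T \<in> M"
    then have "mono T \<in> (elts_on M :: 'k elt set)" "is_lead (mono T :: 'k elt) T"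
      by (auto simp: elts_on_def mono_def is_lead_def)
    then show "T \<in> leads (elts_on M :: 'k elt set)" unfolding leads_def by blast
  qed
qed (simp add: leads_subset)

lemma max_encode_exists:
  assumes "finite P" "P \<noteq> {}"
  obtains T where "T \<in> P" "\<forall>S\<in>P. set_encode S \<le> set_encode T"
proof -
  have "Max (set_encode ` P) \<in> set_encode ` P" using assms by (intro Max_in) auto
  then obtain T where "T \<in> P" "set_encode T = Max (set_encode ` P)" by auto
  then show ?thesis using that assms(1) by simp
qed

lemma lead_exists:
  assumes "f \<in> elts_on M" "finite M" "f \<noteq> 0"
  obtains T where "is_lead f T"
proof -
  have fin: "finite {S. f S \<noteq> 0}"
    using assms(1,2) by (auto simp: elts_on_def intro: finite_subset)
  moreover have "{S. f S \<noteq> 0} \<noteq> {}" using assms(3) by (auto simp: fun_eq_iff)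
  ultimately obtain T where "T \<in> {S. f S \<noteq> 0}"
    "\<forall>S\<in>{S. f S \<noteq> 0}. set_encode S \<le> set_encode T"
    by (rule max_encode_exists)
  then show ?thesis using that by (auto simp: is_lead_def)
qed

text \<open>A choice of one element of \<open>W\<close> for each leading monomial is a basis of \<open>W\<close>.\<close>

lemma dim_eq_card_leads:
  fixes W :: "'k::field elt set"
  assumes W: "elt.subspace W" "W \<subseteq> elts_on M" and M: "finite M" "\<And>S. S \<in> M \<Longrightarrow> finite S"
  shows "elt.dim W = card (leads W)"
proof -
  obtain b where b: "\<And>T. T \<in> leads W \<Longrightarrow> b T \<in> W \<and> is_lead (b T) T"
    using bchoice[of "leads W" "\<lambda>T f. f \<in> W \<and> is_lead f T"] unfolding leads_def by blast
  have fin: "finite (leads W)" using leads_subset[OF W(2)] M(1) finite_subset by blast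
  \<comment> \<open>Injectivity of the encoding on finite sets makes the bound in
    \<open>is_lead\<close> strict away from \<open>T\<close>.\<close>
  have enc: "set_encode S < set_encode T"
    if "T \<in> leads W" "b T S \<noteq> 0" "S \<noteq> T" for S T
  proof -
    have "S \<in> M" "T \<in> M"
      using b[OF that(1)] W(2) that by (auto simp: elts_on_def is_lead_def)
    then have "set_encode S \<noteq> set_encode T" using M(2) that(3) by (metis set_encode_inverse)
    then show ?thesis using b[OF that(1)] that(2) by (auto simp: is_lead_def order_less_le)
  qed
  have inj: "inj_on b (leads W)"
    by (rule inj_onI) (metis b enc is_lead_def less_asym)
  have indep: "elt.independent (b ` leads W)"
  proof (rule elt.independent_if_scalars_zero)
    show "finite (b ` leads W)" using fin by simp
  next
    fix c x assume sum0: "(\<Sum>x\<in>b ` leads W. sc (c x) x) = 0" and x: "x \<in> b ` leads W"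
    show "c x = 0"
    proof (rule ccontr)
      assume "c x \<noteq> 0"
      \<comment> \<open>Let \<open>T\<close> be the largest leading monomial occurring with nonzero
        coefficient. Every other such term vanishes at \<open>T\<close>, since otherwise its leading
        monomial would be larger.\<close>
      let ?P = "{T \<in> leads W. c (b T) \<noteq> 0}"
      have "finite ?P" "?P \<noteq> {}" using fin x \<open>c x \<noteq> 0\<close> by auto
      then obtain T where T: "T \<in> ?P" "\<forall>S\<in>?P. set_encode S \<le> set_encode T"
        by (rule max_encode_exists)
      have "0 = (\<Sum>S\<in>leads W. sc (c (b S)) (b S)) T"
        using sum0 by (simp add: sum.reindex[OF inj])
      also have "\<dots> = (\<Sum>S\<in>leads W. c (b S) * b S T)" by (simp add: sum_apply sc_def)
      also have "\<dots> = (\<Sum>S\<in>{T}. c (b S) * b S T)"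
      proof (rule sum.mono_neutral_right[OF fin])
        show "\<forall>S\<in>leads W - {T}. c (b S) * b S T = 0"
          using T enc by (metis (mono_tags, lifting) DiffE insertI1 leD mem_Collect_eq mult_eq_0_iff)
      qed (use T in auto)
      finally show False using T(1) b by (auto simp: is_lead_def)
    qed
  qed
  have span: "f \<in> elt.span (b ` leads W)" if "f \<in> W" for f
    using that
  \<comment> \<open>The measure is 0 for the zero function and raised by \<open>Suc\<close>
    otherwise, because the empty set, i.e. the monomial 1, already has encoding 0.\<close>
  proof (induction "if f = 0 then 0 else Suc (Max (set_encode ` {S. f S \<noteq> 0}))"
      arbitrary: f rule: less_induct)
    case less
    show ?case
    proof (cases "f = 0")
      case True
      then show ?thesis by (simp add: elt.span_zero)
    next
      case False
      have supp: "finite {S. g S \<noteq> 0}" if "g \<in> W" for g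
        using that W(2) M(1) by (auto simp: elts_on_def intro: finite_subset)
      obtain T where T: "is_lead f T"
        using lead_exists[of f M] less.prems W(2) M(1) False by blast
      then have TW: "T \<in> leads W" using less.prems by (auto simp: leads_def)
      \<comment> \<open>Gaussian elimination: this multiple of \<open>b T\<close> cancels the
        coefficient at \<open>T\<close> and leaves only smaller monomials.\<close>
      define g where "g = f - sc (f T / b T T) (b T)"
      have gW: "g \<in> W"
        unfolding g_def using b[OF TW] less.prems W(1)
        by (intro elt.subspace_diff elt.subspace_scale) auto
      have g_lt: "set_encode S < set_encode T" if "g S \<noteq> 0" for S
      proof -
        have "S \<noteq> T" using that b[OF TW] by (auto simp: g_def sc_def is_lead_def)
        moreover have "f S \<noteq> 0 \<or> b T S \<noteq> 0" using that by (auto simp: g_def sc_def)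
        moreover have "S \<in> M" "T \<in> M"
          using that gW TW leads_subset[OF W(2)] W(2) by (auto simp: elts_on_def)
        ultimately show ?thesis
          using T enc[OF TW] M(2) unfolding is_lead_def
          by (metis order_less_le set_encode_inverse)
      qed
      have f_max: "Max (set_encode ` {S. f S \<noteq> 0}) = set_encode T"
        using T supp[OF less.prems] by (intro Max_eqI) (auto simp: is_lead_def)
      have "g \<in> elt.span (b ` leads W)"
      proof (rule less.hyps[OF _ gW])
        show "(if g = 0 then 0 else Suc (Max (set_encode ` {S. g S \<noteq> 0})))
          < (if f = 0 then 0 else Suc (Max (set_encode ` {S. f S \<noteq> 0})))"
        proof (cases "g = 0")
          case g0: False
          then have "{S. g S \<noteq> 0} \<noteq> {}" by (auto simp: fun_eq_iff)
          then have "Max (set_encode ` {S. g S \<noteq> 0}) < set_encode T"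
            using supp[OF gW] g_lt by (subst Max_less_iff) auto
          then show ?thesis using False g0 f_max by simp
        qed (use False in auto)
      qed
      then have "g + sc (f T / b T T) (b T) \<in> elt.span (b ` leads W)"
        using TW by (meson elt.span_add elt.span_base elt.span_scale imageI)
      then show ?thesis by (simp add: g_def)
    qed
  qed
  show ?thesis
    by (rule elt.dim_unique[OF _ _ indep])
      (use b span in \<open>auto simp: card_image[OF inj]\<close>)
qed

section \<open>Multiplication by variables\<close>

text \<open>Adding an absent \<open>j\<close> to a finite set adds 2^j to its encoding, so
  multiplication by x_j preserves the order of the monomials it does not kill. A leading monomial
  without \<open>j\<close> survives and leads the product.\<close>

lemma shadow_leads_subset:
  fixes W :: "'k::field elt set"
  assumes "W \<subseteq> elts_on M" "\<And>S. S \<in> M \<Longrightarrow> finite S"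
  shows "shadow J (leads W) \<subseteq> leads (elt.span (\<Union>j\<in>J. mulx j ` W))"
proof
  fix T assume "T \<in> shadow J (leads W)"
  then obtain j S where S: "j \<in> J" "S \<in> leads W" "j \<notin> S" "T = insert j S" by (rule shadowE)
  then obtain f where f: "f \<in> W" "is_lead f S" by (auto simp: leads_def)
  have "set_encode U \<le> set_encode T" if "mulx j f U \<noteq> 0" for U
  proof -
    have U: "j \<in> U" "f (U - {j}) \<noteq> 0" using that by (auto simp: mulx_def split: if_splits)
    then have "U - {j} \<in> M" "S \<in> M" using assms(1) f S(2) leads_subset[OF assms(1)]
      by (auto simp: elts_on_def)
    then have "finite (U - {j})" "finite S" using assms(2) by blast+
    moreover have "set_encode (U - {j}) \<le> set_encode S" using f U by (auto simp: is_lead_def)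
    moreover have "U = insert j (U - {j})" using U by auto
    ultimately show ?thesis
      using S(3,4) by (metis DiffE add_left_mono insertI1 set_encode_insert)
  qed
  moreover have "mulx j f T \<noteq> 0" using f S by (auto simp: mulx_def is_lead_def)
  ultimately have "is_lead (mulx j f) T" by (simp add: is_lead_def)
  moreover have "mulx j f \<in> elt.span (\<Union>j\<in>J. mulx j ` W)"
    by (rule elt.span_base) (use S f in auto)
  ultimately show "T \<in> leads (elt.span (\<Union>j\<in>J. mulx j ` W))" unfolding leads_def by blast
qed

lemma span_mulx_subset:
  fixes W :: "'k::field elt set"
  assumes "W \<subseteq> elts_on M"
  shows "elt.span (\<Union>j\<in>J. mulx j ` W) \<subseteq> elts_on (shadow J M)"
proof (rule elt.span_minimal[OF _ subspace_elts_on], clarify)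
  fix j f assume jf: "j \<in> J" "f \<in> W"
  have "S \<in> shadow J M" if "mulx j f S \<noteq> 0" for S
  proof -
    have "j \<in> S" "S - {j} \<in> M"
      using that jf assms by (auto simp: mulx_def elts_on_def split: if_splits)
    then show ?thesis using shadowI[of j J "S - {j}" M] jf by (simp add: insert_absorb)
  qed
  then show "mulx j f \<in> elts_on (shadow J M)" by (simp add: elts_on_def)
qed

text \<open>For monomial spaces the shadow describes the product exactly, because each monomial of
  the shadow is itself a variable times a monomial from \<open>M\<close>.\<close>

lemma span_mulx_elts_on:
  assumes "finite M" "finite J"
  shows "elt.span (\<Union>j\<in>J. mulx j ` elts_on M) = (elts_on (shadow J M) :: 'k::field elt set)"
proof
  show "(elts_on (shadow J M) :: 'k elt set) \<subseteq> elt.span (\<Union>j\<in>J. mulx j ` elts_on M)"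
    unfolding elts_on_eq_span[OF finite_shadow[OF assms(2,1)]]
  proof (rule elt.span_mono, clarify)
    fix T assume "T \<in> shadow J M"
    then obtain j S where S: "j \<in> J" "S \<in> M" "j \<notin> S" "T = insert j S" by (rule shadowE)
    then have "(mono T :: 'k elt) = mulx j (mono S)"
      by (auto simp: mono_def mulx_def fun_eq_iff)
    moreover have "(mono S :: 'k elt) \<in> elts_on M" using S by (auto simp: elts_on_def mono_def)
    ultimately show "(mono T :: 'k elt) \<in> (\<Union>j\<in>J. mulx j ` elts_on M)" using S by blast
  qed
qed (simp add: span_mulx_subset)

lemma elts_on_cone:
  assumes "\<And>S. S \<in> M0 \<Longrightarrow> i \<notin> S" "\<And>S. S \<in> M1 \<Longrightarrow> i \<notin> S"
  shows "{a + mulx i b | a b. a \<in> elts_on M0 \<and> b \<in> elts_on M1}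
    = (elts_on (M0 \<union> insert i ` M1) :: 'k::field elt set)" (is "?L = ?R")
proof
  show "?L \<subseteq> ?R"
  proof clarify
    fix a b :: "'k elt" assume ab: "a \<in> elts_on M0" "b \<in> elts_on M1"
    have "S \<in> M0 \<union> insert i ` M1" if "(a + mulx i b) S \<noteq> 0" for S
    proof (cases "a S = 0")
      case True
      then have "i \<in> S" "S - {i} \<in> M1"
        using that ab by (auto simp: mulx_def elts_on_def split: if_splits)
      then show ?thesis by (metis UnI2 image_eqI insert_Diff)
    qed (use ab in \<open>auto simp: elts_on_def\<close>)
    then show "a + mulx i b \<in> ?R" by (simp add: elts_on_def)
  qed
  show "?R \<subseteq> ?L"
  proof
    fix f :: "'k elt" assume f: "f \<in> ?R"
    \<comment> \<open>\<open>a\<close> collects the terms free of x_i, and \<open>b\<close> is the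
      cofactor of x_i. Setting \<open>b\<close> to 0 on sets containing \<open>i\<close> keeps its
      support inside \<open>M1\<close>.\<close>
    define a b where "a = (\<lambda>S. if i \<in> S then 0 else f S)"
      and "b = (\<lambda>S. if i \<in> S then 0 else f (insert i S))"
    have "a \<in> elts_on M0" using f by (auto simp: a_def elts_on_def)
    moreover have "b \<in> elts_on M1"
      unfolding elts_on_def
    proof clarify
      fix S assume "b S \<noteq> 0"
      then have S: "i \<notin> S" "insert i S \<in> M0 \<union> insert i ` M1"
        using f by (auto simp: b_def elts_on_def split: if_splits)
      then obtain S' where "S' \<in> M1" "insert i S = insert i S'" using assms(1) by blast
      then show "S \<in> M1" using S(1) assms(2) by (metis insert_ident)
    qed
    moreover have "f = a + mulx i b"
      by (auto simp: a_def b_def mulx_def fun_eq_iff insert_absorb)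
    ultimately show "f \<in> ?L" by blast
  qed
qed

section \<open>From dimensions to cardinalities\<close>

lemma elts_on_mono: "M \<subseteq> M' \<Longrightarrow> elts_on M \<subseteq> elts_on M'"
  by (auto simp: elts_on_def)

lemma vdim_elts_on:
  assumes "finite M" "\<And>S. S \<in> M \<Longrightarrow> finite S"
  shows "vdim (elts_on M :: 'k::field elt set) = card M"
  unfolding vdim_def
  using dim_eq_card_leads[OF subspace_elts_on order_refl assms, where ?'k = 'k]
  by (simp add: leads_elts_on)

lemma finite_mem_shadow:
  "T \<in> shadow J M \<Longrightarrow> (\<And>S. S \<in> M \<Longrightarrow> finite S) \<Longrightarrow> finite T"
  by (auto elim!: shadowE)

lemma finite_mem_monsQ: "S \<in> monsQ n i d \<Longrightarrow> finite S"
  by (auto simp: monsQ_def intro: finite_subset)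

lemma finite_mem_monsR: "S \<in> monsR n d \<Longrightarrow> finite S"
  by (auto simp: monsR_def intro: finite_subset)

lemma n1_elts_on:
  "finite M \<Longrightarrow> n1 n i (elts_on M) = (elts_on (shadow ({..<n} - {i}) M) :: 'k::field elt set)"
  by (simp add: n1_def vspan_def span_mulx_elts_on)

lemma m1_elts_on:
  "finite M \<Longrightarrow> m1 n (elts_on M) = (elts_on (shadow {..<n} M) :: 'k::field elt set)"
  by (simp add: m1_def vspan_def span_mulx_elts_on)

text \<open>The Gotzmann condition is tested against the monomial space on \<open>B\<close>. This
  supplies \<open>min0\<close> and \<open>min1\<close> in
  \<open>card_shadow_cone_le\<close>.\<close>

lemma gotzmann_Q_card_shadow_le:
  assumes "gotzmann_Q n i d (elts_on M :: 'k::field elt set)" "M \<subseteq> monsQ n i d"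
    "B \<subseteq> monsQ n i d" "card B = card M"
  shows "card (shadow ({..<n} - {i}) M) \<le> card (shadow ({..<n} - {i}) B)"
proof -
  have fin: "finite F" "\<And>S. S \<in> F \<Longrightarrow> finite S"
    "finite (shadow ({..<n} - {i}) F)" "\<And>T. T \<in> shadow ({..<n} - {i}) F \<Longrightarrow> finite T"
    if "F \<subseteq> monsQ n i d" for F
  proof -
    show 1: "finite F" using that finite_monsQ finite_subset by blast
    show 2: "finite S" if "S \<in> F" for S using that \<open>F \<subseteq> _\<close> finite_mem_monsQ by blast
    show "finite (shadow ({..<n} - {i}) F)" using 1 by (simp add: finite_shadow)
    show "finite T" if "T \<in> shadow ({..<n} - {i}) F" for T
      using that 2 by (rule finite_mem_shadow)
  qed
  have "vdim (n1 n i (elts_on M :: 'k elt set)) \<le> vdim (n1 n i (elts_on B :: 'k elt set))"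
    using assms unfolding gotzmann_Q_def vsubspace_def
    by (simp add: subspace_elts_on elts_on_mono vdim_elts_on fin)
  then show ?thesis
    using assms(2,3) by (simp add: n1_elts_on vdim_elts_on fin)
qed

theorem theorem4p10:
  fixes V0 V1 :: "'k::field elt set" and n i d :: nat
  assumes "i < n" and "d \<ge> 1"
    and "monomial_space_in (monsQ n i d) V0"
    and "monomial_space_in (monsQ n i (d - 1)) V1"
    and "gotzmann_Q n i d V0"
    and "gotzmann_Q n i (d - 1) V1"
    and "V0 = n1 n i V1"
  shows "gotzmann_R n d {a + mulx i b | a b. a \<in> V0 \<and> b \<in> V1}"
proof -
  let ?Q = "{..<n} - {i}"
  obtain M1 where M1: "M1 \<subseteq> monsQ n i (d - 1)" "V1 = vspan (mono ` M1)"
    using assms(4) by (auto simp: monomial_space_in_def)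
  have finM1: "finite M1" using M1(1) finite_monsQ finite_subset by blast
  have V1: "V1 = elts_on M1" by (simp add: M1(2) vspan_def elts_on_eq_span finM1)
  define M0 where "M0 = shadow ?Q M1"
  have finM0: "finite M0" by (simp add: M0_def finM1 finite_shadow)
  have V0: "V0 = elts_on M0" using assms(7) by (simp add: V1 n1_elts_on finM1 M0_def)
  \<comment> \<open>Containment of spaces passes to monomials, since the leading monomials of
    \<open>elts_on M0\<close> are exactly \<open>M0\<close>.\<close>
  have M0: "M0 \<subseteq> monsQ n i d"
    using assms(5) leads_subset[of V0] by (simp add: gotzmann_Q_def V0 leads_elts_on)
  define M where "M = M0 \<union> insert i ` M1"
  have V: "{a + mulx i b | a b. a \<in> V0 \<and> b \<in> V1} = elts_on M"
    unfolding V0 V1 M_def by (rule elts_on_cone) (use M0 M1(1) in \<open>auto simp: monsQ_def\<close>)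
  have M_sub: "M \<subseteq> monsR n d"
  proof -
    have "insert i S \<in> monsR n d" if "S \<in> M1" for S
    proof -
      have "S \<in> monsQ n i (d - 1)" using that M1(1) by blast
      then show ?thesis
        using finite_mem_monsQ[of S] assms(1,2) by (auto simp: monsQ_def monsR_def card_insert_if)
    qed
    then show ?thesis using M0 by (auto simp: M_def monsQ_def monsR_def)
  qed
  have finM: "finite M" "\<And>S. S \<in> M \<Longrightarrow> finite S"
    using M_sub finite_monsR finite_subset finite_mem_monsR by blast+
  have "vdim (m1 n (elts_on M :: 'k elt set)) \<le> vdim (m1 n W)"
    if W: "vsubspace W" "W \<subseteq> elts_on (monsR n d)" "vdim W = vdim (elts_on M :: 'k elt set)"
    for W :: "'k elt set"
  proof -
    \<comment> \<open>\<open>leads W\<close> thereby becomes an admissible competitor in the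
      combinatorial inequality.\<close>
    have "card (leads W) = card M"
      using W(3) dim_eq_card_leads[OF W(1)[unfolded vsubspace_def] W(2) finite_monsR finite_mem_monsR]
        vdim_elts_on[OF finM, where ?'k = 'k]
      by (simp add: vdim_def)
    then have "card (shadow {..<n} M) \<le> card (shadow {..<n} (leads W))"
      unfolding M_def using assms(1,2,5,6) M0 M1(1) leads_subset[OF W(2)]
      by (intro card_shadow_cone_le[OF _ _ _ M0_def])
        (auto simp: V0 V1 gotzmann_Q_card_shadow_le)
    \<comment> \<open>Cancellation can give \<open>m1 n W\<close> further leading monomials, so in
      general this is only an inequality, in the direction required.\<close>
    also have "\<dots> \<le> card (leads (m1 n W))"
    proof (rule card_mono)
      have sub: "m1 n W \<subseteq> elts_on (shadow {..<n} (monsR n d))"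
        unfolding m1_def vspan_def by (rule span_mulx_subset[OF W(2)])
      then show "finite (leads (m1 n W))"
        by (rule finite_subset[OF leads_subset]) (simp add: finite_shadow finite_monsR)
      show "shadow {..<n} (leads W) \<subseteq> leads (m1 n W)"
        unfolding m1_def vspan_def by (rule shadow_leads_subset[OF W(2) finite_mem_monsR])
    qed
    also have "\<dots> = vdim (m1 n W)"
      unfolding m1_def vspan_def vdim_def
      by (rule dim_eq_card_leads[OF elt.subspace_span span_mulx_subset[OF W(2)], symmetric])
        (auto simp: finite_shadow finite_monsR intro: finite_mem_shadow finite_mem_monsR)
    finally show ?thesis
      using finM finite_mem_shadow[of _ "{..<n}" M]
      by (simp add: m1_elts_on vdim_elts_on finite_shadow)
  qed
  then show ?thesis
    unfolding V gotzmann_R_def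
    using M_sub by (simp add: vsubspace_def subspace_elts_on elts_on_mono)
qed

end
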